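(* Let $V$ and $E$ be finite sets and let $F\colon 2^V\to\mathbb{R}_+^E$ be a normalized submodular transformation. Then the effective resistance $R_F$ satisfies the triangle inequality: for all $u,v,w\in V$, $R_F(u,v)+R_F(v,w)\ge R_F(u,w)$.
   Context: A transformation $F\colon 2^V\to\mathbb{R}_+^E$ is a submodular transformation if for each $e\in E$ the function $F_e(S)=F(S)(e)$ is (non-negative) submodular; normalized means $F(\emptyset)=F(V)={\bm 0}$. For $G\colon 2^V\to\mathbb{R}$, $B(G)=\{{\bm w}\in\mathbb{R}^V: {\bm w}(S)\le G(S)\ \forall S,\ {\bm w}(V)=G(V)\}$ with ${\bm w}(S)=\sum_{v\in S}{\bm w}(v)$. The Lovász extension of $F_e$ is $f_e({\bm x})=\max_{{\bm w}\in B(F_e)}\langle {\bm x},{\bm w}\rangle$, with $\partial f_e({\bm x})=\mathrm{argmax}_{{\bm w}\in B(F_e)}\langle {\bm x},{\bm w}\rangle$, and the Laplacian is $L_F({\bm x})=\{\sum_{e\in E}{\bm w}_e\langle {\bm w}_e,{\bm x}\rangle : {\bm w}_e\in\partial f_e({\bm x})\}$. Let ${\bm e}_v$ denote the $v$-th standard unit vector. The effective resistance is $R_F(u,v)=\langle {\bm e}_u-{\bm e}_v,{\bm x}\rangle$, where ${\bm x}\in\mathbb{R}^V$ is any vector with ${\bm e}_u-{\bm e}_v\in L_F({\bm x})$ (the value does not depend on the choice of ${\bm x}$), and $R_F(u,v)=\infty$ if no such ${\bm x}$ exists; the usual conventions for $\infty$ apply in the inequality. *)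

theory Defs
  imports "HOL-Analysis.Analysis"
begin

definition submodular :: "('v set \<Rightarrow> real) \<Rightarrow> bool" where
  "submodular G \<longleftrightarrow> (\<forall>S T. G S + G T \<ge> G (S \<union> T) + G (S \<inter> T))"

text \<open>The ground set \<open>V\<close> is the universe of a finite type \<open>'v\<close>. The index set \<open>E\<close> is an explicit
  set, so that it may be empty; the values \<open>F S e\<close> for \<open>e \<notin> E\<close> are irrelevant.\<close>

definition submodular_transformation :: "'e set \<Rightarrow> ('v set \<Rightarrow> 'e \<Rightarrow> real) \<Rightarrow> bool" where
  "submodular_transformation E F \<longleftrightarrow>
     (\<forall>e\<in>E. (\<forall>S. F S e \<ge> 0) \<and> submodular (\<lambda>S. F S e))"

definition normalized :: "'e set \<Rightarrow> ('v set \<Rightarrow> 'e \<Rightarrow> real) \<Rightarrow> bool" where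
  "normalized E F \<longleftrightarrow> (\<forall>e\<in>E. F {} e = 0 \<and> F UNIV e = 0)"

definition base_polytope :: "('v::finite set \<Rightarrow> real) \<Rightarrow> (real ^ 'v) set" where
  "base_polytope G =
     {w. (\<forall>S. (\<Sum>v\<in>S. w $ v) \<le> G S) \<and> (\<Sum>v\<in>UNIV. w $ v) = G UNIV}"

text \<open>The subdifferential at \<open>x\<close> of the Lovasz extension \<open>x \<mapsto> max {x \<bullet> w | w \<in> B(G)}\<close> of \<open>G\<close>.\<close>

definition lovasz_subdiff :: "('v::finite set \<Rightarrow> real) \<Rightarrow> real ^ 'v \<Rightarrow> (real ^ 'v) set" where
  "lovasz_subdiff G x = {w. is_arg_max (\<lambda>w. x \<bullet> w) (\<lambda>w. w \<in> base_polytope G) w}"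

definition laplacian ::
    "'e set \<Rightarrow> ('v::finite set \<Rightarrow> 'e \<Rightarrow> real) \<Rightarrow> real ^ 'v \<Rightarrow> (real ^ 'v) set" where
  "laplacian E F x =
     {\<Sum>e\<in>E. (w e \<bullet> x) *\<^sub>R w e | w. \<forall>e\<in>E. w e \<in> lovasz_subdiff (\<lambda>S. F S e) x}"

definition effective_resistance ::
    "'e set \<Rightarrow> ('v::finite set \<Rightarrow> 'e \<Rightarrow> real) \<Rightarrow> 'v \<Rightarrow> 'v \<Rightarrow> ereal" where
  "effective_resistance E F u v =
     (if \<exists>x. axis u 1 - axis v 1 \<in> laplacian E F x
      then ereal ((axis u 1 - axis v 1) \<bullet> (SOME x. axis u 1 - axis v 1 \<in> laplacian E F x))
      else \<infinity>)"

text \<open>The value does not depend on the vector chosen in \<open>effective_resistance\<close>.\<close>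

lemma laplacian_inner_unique:
  assumes F: "submodular_transformation E F" "normalized E F"
    and b: "b \<in> laplacian E F x" "b \<in> laplacian E F y"
  shows "b \<bullet> x = b \<bullet> y"
proof -
  obtain w where w: "\<And>e. e \<in> E \<Longrightarrow> w e \<in> lovasz_subdiff (\<lambda>S. F S e) x"
    and bw: "b = (\<Sum>e\<in>E. (w e \<bullet> x) *\<^sub>R w e)"
    using b(1) unfolding laplacian_def by auto
  obtain z where z: "\<And>e. e \<in> E \<Longrightarrow> z e \<in> lovasz_subdiff (\<lambda>S. F S e) y"
    and bz: "b = (\<Sum>e\<in>E. (z e \<bullet> y) *\<^sub>R z e)"
    using b(2) unfolding laplacian_def by auto
  have zero: "0 \<in> base_polytope (\<lambda>S. F S e)" if "e \<in> E" for e
    using F that by (auto simp: base_polytope_def submodular_transformation_def normalized_def)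
  have wB: "w e \<in> base_polytope (\<lambda>S. F S e)" "z e \<in> base_polytope (\<lambda>S. F S e)" if "e \<in> E" for e
    using w[OF that] z[OF that] by (auto simp: lovasz_subdiff_def is_arg_max_def)
  have max: "w' \<bullet> x \<le> w e \<bullet> x" "w' \<bullet> y \<le> z e \<bullet> y"
    if "e \<in> E" "w' \<in> base_polytope (\<lambda>S. F S e)" for e w'
    using w[OF that(1)] z[OF that(1)] that(2)
    by (auto simp: lovasz_subdiff_def is_arg_max_def inner_commute not_less)
  have nonneg: "0 \<le> w e \<bullet> x" "0 \<le> z e \<bullet> y" if "e \<in> E" for e
    using max[OF that zero[OF that]] by auto
  have bx: "b \<bullet> x = (\<Sum>e\<in>E. (w e \<bullet> x)\<^sup>2)"
    unfolding bw by (simp add: inner_sum_left power2_eq_square)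
  have by_eq: "b \<bullet> y = (\<Sum>e\<in>E. (z e \<bullet> y)\<^sup>2)"
    unfolding bz by (simp add: inner_sum_left power2_eq_square)
  have "b \<bullet> y = (\<Sum>e\<in>E. (w e \<bullet> x) * (w e \<bullet> y))"
    unfolding bw by (simp add: inner_sum_left)
  also have "\<dots> \<le> (\<Sum>e\<in>E. (w e \<bullet> x) * (z e \<bullet> y))"
    by (intro sum_mono mult_left_mono max nonneg wB)
  finally have 1: "b \<bullet> y \<le> (\<Sum>e\<in>E. (w e \<bullet> x) * (z e \<bullet> y))" .
  have "b \<bullet> x = (\<Sum>e\<in>E. (z e \<bullet> y) * (z e \<bullet> x))"
    unfolding bz by (simp add: inner_sum_left)
  also have "\<dots> \<le> (\<Sum>e\<in>E. (z e \<bullet> y) * (w e \<bullet> x))"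
    by (intro sum_mono mult_left_mono max nonneg wB)
  finally have 2: "b \<bullet> x \<le> (\<Sum>e\<in>E. (w e \<bullet> x) * (z e \<bullet> y))"
    by (simp add: mult.commute)
  show ?thesis
  proof (cases "finite E")
    case False
    then show ?thesis by (simp add: bx by_eq)
  next
    case True
    have "(\<Sum>e\<in>E. (w e \<bullet> x - z e \<bullet> y)\<^sup>2) =
        b \<bullet> x + b \<bullet> y - 2 * (\<Sum>e\<in>E. (w e \<bullet> x) * (z e \<bullet> y))"
      by (simp add: bx by_eq power2_diff sum_subtractf sum.distrib sum_distrib_left mult.assoc)
    with 1 2 have "(\<Sum>e\<in>E. (w e \<bullet> x - z e \<bullet> y)\<^sup>2) \<le> 0"
      by linarith
    then have "(\<Sum>e\<in>E. (w e \<bullet> x - z e \<bullet> y)\<^sup>2) = 0"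
      by (intro antisym sum_nonneg) auto
    then have "\<forall>e\<in>E. w e \<bullet> x = z e \<bullet> y"
      using True by (simp add: sum_nonneg_eq_0_iff)
    then show ?thesis by (simp add: bx by_eq)
  qed
qed

lemma effective_resistance_eq:
  assumes "submodular_transformation E F" "normalized E F"
    and "axis u 1 - axis v 1 \<in> laplacian E F x"
  shows "effective_resistance E F u v = ereal ((axis u 1 - axis v 1) \<bullet> x)"
proof -
  have "axis u 1 - axis v 1 \<in> laplacian E F (SOME x. axis u 1 - axis v 1 \<in> laplacian E F x)"
    using assms(3) by (rule someI)
  from laplacian_inner_unique[OF assms(1,2) this assms(3)] assms(3) show ?thesis
    unfolding effective_resistance_def by auto
qed

end

theory Submission
  imports Defs
begin

text \<open>
  Let \<open>x\<close> be a potential for \<open>e_u - e_w\<close>. The effective resistance of \<open>(u, v)\<close> is the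
  maximum of \<open>2 (y_u - y_v) - (\<Sum>e. (f_e y)\<^sup>2)\<close> over \<open>y\<close>; testing with \<open>y = max x x_v - x_v\<close>
  gives at least \<open>x_u - x_v\<close>, because a truncation of \<open>x\<close> is comonotone with \<open>x\<close> and so has
  the same maximisers \<open>w_e\<close>. Symmetrically \<open>(v, w)\<close> has resistance at least \<open>x_v - x_w\<close>.

  If the resistances of \<open>(u, v)\<close> and \<open>(v, w)\<close> are finite, adding their flows writes \<open>e_u - e_w\<close> as
  a nonnegative combination of points of the base polytopes. Each Lovasz extension is linear and
  nonnegative on the cone of vectors with a given chain of level sets, so the concave quadratic
  objective attains its maximum, and a maximiser is a potential for \<open>e_u - e_w\<close>.
\<close>

section \<open>Level sets and the base polytope\<close>

definition ind :: "'v::finite set \<Rightarrow> real ^ 'v" where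
  "ind S = (\<chi> v. if v \<in> S then 1 else 0)"

lemma inner_ind: "w \<bullet> ind S = (\<Sum>v\<in>S. w $ v)"
  by (simp add: ind_def inner_vec_def if_distrib[of "\<lambda>z. _ * z"] sum.If_cases cong: if_cong)

lemma norm_ind_le: "norm (ind S :: real ^ 'v::finite) \<le> real CARD('v)"
proof -
  have "norm (ind S :: real ^ 'v) \<le> (\<Sum>i\<in>UNIV. \<bar>ind S $ i\<bar>)"
    by (rule norm_le_l1_cart)
  also have "\<dots> \<le> (\<Sum>i\<in>(UNIV :: 'v set). 1)"
    by (intro sum_mono) (auto simp: ind_def)
  finally show ?thesis by simp
qed

lemma base_polytope_ind:
  "w \<in> base_polytope G \<longleftrightarrow> (\<forall>S. w \<bullet> ind S \<le> G S) \<and> w \<bullet> ind UNIV = G UNIV"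
  by (simp add: base_polytope_def inner_ind)

lemma lovasz_subdiff_iff:
  "w \<in> lovasz_subdiff G x \<longleftrightarrow>
     w \<in> base_polytope G \<and> (\<forall>w' \<in> base_polytope G. x \<bullet> w' \<le> x \<bullet> w)"
  by (auto simp: lovasz_subdiff_def is_arg_max_linorder)

section \<open>Superlevel sets and the layer-cake decomposition\<close>

text \<open>These are the superlevel sets of \<open>x\<close>, including \<open>{}\<close> and
  \<open>UNIV\<close>. The implication \<open>upset y S\<close> to \<open>upset x S\<close> for all
  \<open>S\<close> serves as the form of comonotonicity of \<open>y\<close> with
  \<open>x\<close>.\<close>

definition upset :: "real ^ 'v::finite \<Rightarrow> 'v set \<Rightarrow> bool" where
  "upset x S \<longleftrightarrow> (\<forall>a\<in>S. \<forall>b\<in>-S. x $ b < x $ a)"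

text \<open>The layer-cake representation, peeling off the set where \<open>x\<close> is maximal.\<close>

lemma layer_cake:
  fixes x :: "real ^ 'v::finite"
  shows "\<exists>t c. (\<forall>S. 0 \<le> t S) \<and> (\<forall>S. 0 < t S \<longrightarrow> upset x S) \<and>
           x = (\<Sum>S\<in>UNIV. t S *\<^sub>R ind S) + c *\<^sub>R ind UNIV"
proof (induction "card (range (($) x))" arbitrary: x rule: less_induct)
  case less
  define m where "m = Max (range (($) x))"
  have le_m: "x $ v \<le> m" for v
    unfolding m_def by (intro Max_ge) auto
  show ?case
  proof (cases "\<forall>v. x $ v = m")
    case True
    then have "x = (\<Sum>S\<in>UNIV. 0 *\<^sub>R ind S) + m *\<^sub>R ind UNIV"
      by (simp add: vec_eq_iff ind_def)
    then show ?thesis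
      by (intro exI[of _ "\<lambda>_. 0"] exI[of _ m]) auto
  next
    case False
    define A where "A = range (($) x) - {m}"
    define m' where "m' = Max A"
    have A: "finite A" "A \<noteq> {}"
      using False by (auto simp: A_def)
    have m': "m' \<in> A"
      unfolding m'_def using A by (rule Max_in)
    obtain i where "m' = x $ i" "m' \<noteq> m"
      using m' by (auto simp: A_def)
    with le_m[of i] have "m' < m" by simp
    have le_m': "x $ v \<le> m'" if "x $ v \<noteq> m" for v
      unfolding m'_def using A that by (intro Max_ge) (auto simp: A_def)
    define S where "S = {v. x $ v = m}"
    \<comment> \<open>Truncating at the second largest value \<open>m'\<close> merges the two top
      levels, so \<open>y\<close> has fewer values than \<open>x\<close>.\<close>
    define y :: "real ^ 'v" where "y = (\<chi> v. min (x $ v) m')"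
    have x: "x = y + (m - m') *\<^sub>R ind S"
    proof (rule iffD2[OF vec_eq_iff], rule allI)
      fix v
      show "x $ v = (y + (m - m') *\<^sub>R ind S) $ v"
        using le_m'[of v] \<open>m' < m\<close> by (cases "x $ v = m") (auto simp: y_def ind_def S_def)
    qed
    have "range (($) y) \<subseteq> A"
      using m' le_m' \<open>m' < m\<close> by (auto simp: y_def A_def min_def)
    then have "card (range (($) y)) \<le> card A"
      using A by (intro card_mono)
    also have "card A < card (range (($) x))"
    proof -
      have "m \<in> range (($) x)"
        unfolding m_def by (intro Max_in) auto
      then show ?thesis
        unfolding A_def by (intro card_Diff1_less) auto
    qed
    finally obtain t c where t: "\<And>T. 0 \<le> t T" "\<And>T. 0 < t T \<Longrightarrow> upset y T"
      and y: "y = (\<Sum>T\<in>UNIV. t T *\<^sub>R ind T) + c *\<^sub>R ind UNIV"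
      using less[of y] by blast
    have up: "upset x T" if "upset y T" for T
    proof -
      have "x $ b < x $ a" if "y $ b < y $ a" for a b
        using that by (auto simp: y_def min_def split: if_splits)
      then show ?thesis
        using that unfolding upset_def by blast
    qed
    have upS: "upset x S"
      using le_m by (auto simp: upset_def S_def less_le)
    define t' where "t' = (\<lambda>T. t T + (if T = S then m - m' else 0))"
    have "(\<Sum>T\<in>UNIV. t' T *\<^sub>R ind T) = (\<Sum>T\<in>UNIV. t T *\<^sub>R ind T) + (m - m') *\<^sub>R ind S"
      by (simp add: t'_def scaleR_add_left sum.distrib if_distrib[of "\<lambda>z. z *\<^sub>R _"] cong: if_cong)
    then have "x = (\<Sum>T\<in>UNIV. t' T *\<^sub>R ind T) + c *\<^sub>R ind UNIV"
      using x y by simp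
    moreover have "\<forall>T. 0 \<le> t' T"
      using t(1) \<open>m' < m\<close> by (auto simp: t'_def)
    moreover have "\<forall>T. 0 < t' T \<longrightarrow> upset x T"
      using t(2) up upS by (auto simp: t'_def)
    ultimately show ?thesis by blast
  qed
qed

section \<open>Tight sets and the optimality criterion for the linear maximisation\<close>

definition tight :: "('v::finite set \<Rightarrow> real) \<Rightarrow> real ^ 'v \<Rightarrow> 'v set \<Rightarrow> bool" where
  "tight G w S \<longleftrightarrow> w \<bullet> ind S = G S"

text \<open>Uncrossing: \<open>w\<close> is modular and \<open>G\<close> submodular, so the slacks
  at the union and the intersection have a sum of at most 0, while neither is negative.\<close>

lemma tight_Un_Int:
  assumes "submodular G" "w \<in> base_polytope G" "tight G w S" "tight G w T"
  shows "tight G w (S \<union> T)" "tight G w (S \<inter> T)"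
proof -
  have "w \<bullet> ind (S \<union> T) + w \<bullet> ind (S \<inter> T) = w \<bullet> ind S + w \<bullet> ind T"
    unfolding inner_ind by (rule sum.union_inter) auto
  moreover have "G S + G T \<ge> G (S \<union> T) + G (S \<inter> T)"
    using assms(1) by (simp add: submodular_def)
  moreover have "w \<bullet> ind (S \<union> T) \<le> G (S \<union> T)" "w \<bullet> ind (S \<inter> T) \<le> G (S \<inter> T)"
    using assms(2) by (auto simp: base_polytope_ind)
  ultimately show "tight G w (S \<union> T)" "tight G w (S \<inter> T)"
    using assms(3,4) by (auto simp: tight_def)
qed

lemma tight_Union_Inter:
  assumes "submodular G" "w \<in> base_polytope G" "G {} = 0"
    and "finite A" "\<And>a. a \<in> A \<Longrightarrow> tight G w (T a)"
  shows "tight G w (\<Union>a\<in>A. T a) \<and> tight G w (\<Inter>a\<in>A. T a)"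
  using assms(4,5)
proof (induction A rule: finite_induct)
  \<comment> \<open>The union is \<open>{}\<close> and the intersection is \<open>UNIV\<close>,
    tight by \<open>G {} = 0\<close> and by the defining equation of the base polytope.\<close>
  case empty
  show ?case
    using assms(2,3) by (auto simp: tight_def inner_ind base_polytope_def)
next
  case (insert a A)
  then show ?case
    using tight_Un_Int[OF assms(1,2)] by simp
qed

text \<open>If no tight set contained \<open>a\<close> but not \<open>b\<close>, moving mass from \<open>b\<close> to \<open>a\<close> would
  stay in the base polytope and increase \<open>x \<bullet> w\<close>.\<close>

lemma tight_separates:
  assumes w: "w \<in> lovasz_subdiff G x" and ab: "x $ b < x $ a"
  shows "\<exists>T. tight G w T \<and> a \<in> T \<and> b \<notin> T"
proof (rule ccontr)
  assume no: "\<not> ?thesis"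
  have wB: "w \<in> base_polytope G"
    using w by (simp add: lovasz_subdiff_iff)
  have wG: "w \<bullet> ind T \<le> G T" for T
    using wB by (auto simp: base_polytope_ind)
  \<comment> \<open>The element 1 keeps \<open>D\<close> nonempty when every set is tight;
    \<open>\<delta>\<close> is then no larger than any positive slack.\<close>
  define D where "D = insert 1 ((\<lambda>T. G T - w \<bullet> ind T) ` {T. \<not> tight G w T})"
  define \<delta> where "\<delta> = Min D"
  have D: "finite D" "D \<noteq> {}" by (auto simp: D_def)
  have "\<forall>r\<in>D. 0 < r"
    using wG by (auto simp: D_def tight_def less_le)
  then have \<delta>: "0 < \<delta>"
    unfolding \<delta>_def using D by simp
  have slack: "\<delta> \<le> G T - w \<bullet> ind T" if "\<not> tight G w T" for T
    unfolding \<delta>_def using D that by (intro Min_le) (auto simp: D_def)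
  define w' where "w' = w + \<delta> *\<^sub>R (axis a 1 - axis b 1)"
  have w'_ind: "w' \<bullet> ind T = w \<bullet> ind T + \<delta> * ((if a \<in> T then 1 else 0) - (if b \<in> T then 1 else 0))"
    for T
    by (simp add: w'_def inner_add_left inner_diff_left inner_axis' ind_def)
  have "w' \<bullet> ind T \<le> G T" for T
  proof (cases "tight G w T")
    \<comment> \<open>By \<open>no\<close>, a tight set containing \<open>a\<close> also contains
      \<open>b\<close>, so the shift cannot increase its weight.\<close>
    case True
    then show ?thesis
      using no wG[of T] \<delta> by (auto simp: w'_ind)
  next
    case False
    then show ?thesis
      using slack[OF False] wG[of T] \<delta> by (auto simp: w'_ind)
  qed
  moreover have "w' \<bullet> ind UNIV = G UNIV"
    using wB by (simp add: w'_ind base_polytope_ind)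
  ultimately have "w' \<in> base_polytope G"
    by (simp add: base_polytope_ind)
  then have "x \<bullet> w' \<le> x \<bullet> w"
    using w by (simp add: lovasz_subdiff_iff)
  moreover have "x \<bullet> w' = x \<bullet> w + \<delta> * (x $ a - x $ b)"
    by (simp add: w'_def inner_add_right inner_diff_right inner_axis)
  ultimately show False
    using \<delta> ab by (simp add: mult_le_0_iff)
qed

text \<open>Sets separating each \<open>a\<close> in \<open>S\<close> from each \<open>b\<close>
  outside are tight by exchange; intersecting over \<open>b\<close> and uniting over
  \<open>a\<close> recovers \<open>S\<close>, and uncrossing preserves tightness.\<close>

lemma tight_upset:
  assumes G: "submodular G" "G {} = 0"
    and w: "w \<in> lovasz_subdiff G x" and S: "upset x S"
  shows "tight G w S"
proof -
  have wB: "w \<in> base_polytope G"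
    using w by (simp add: lovasz_subdiff_iff)
  have "\<forall>a\<in>S. \<forall>b\<in>-S. \<exists>T. tight G w T \<and> a \<in> T \<and> b \<notin> T"
    using S tight_separates[OF w] by (auto simp: upset_def)
  then obtain T where T: "\<And>a b. a \<in> S \<Longrightarrow> b \<in> -S \<Longrightarrow> tight G w (T a b) \<and> a \<in> T a b \<and> b \<notin> T a b"
    by metis
  have "tight G w (\<Union>a\<in>S. \<Inter>b\<in>-S. T a b)"
    using T by (intro tight_Union_Inter[OF G(1) wB G(2), THEN conjunct1]
        tight_Union_Inter[OF G(1) wB G(2), THEN conjunct2]) auto
  moreover have "(\<Union>a\<in>S. \<Inter>b\<in>-S. T a b) = S"
    using T by blast
  ultimately show ?thesis by simp
qed

text \<open>By the layer cake, \<open>x \<bullet> w\<close> is a nonnegative combination of the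
  weights of up-sets plus a term fixed on the base polytope, so tightness on up-sets suffices for
  optimality. The subdifferential thus depends on \<open>x\<close> only through its up-sets.\<close>

lemma lovasz_subdiff_tight:
  assumes G: "submodular G" "G {} = 0"
  shows "w \<in> lovasz_subdiff G x \<longleftrightarrow> w \<in> base_polytope G \<and> (\<forall>S. upset x S \<longrightarrow> tight G w S)"
proof
  assume "w \<in> lovasz_subdiff G x"
  then show "w \<in> base_polytope G \<and> (\<forall>S. upset x S \<longrightarrow> tight G w S)"
    using tight_upset[OF G] by (auto simp: lovasz_subdiff_iff)
next
  assume w: "w \<in> base_polytope G \<and> (\<forall>S. upset x S \<longrightarrow> tight G w S)"
  obtain t c where t: "\<And>S. 0 \<le> t S" "\<And>S. 0 < t S \<Longrightarrow> upset x S"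
    and x: "x = (\<Sum>S\<in>UNIV. t S *\<^sub>R ind S) + c *\<^sub>R ind UNIV"
    using layer_cake[of x] by blast
  have x_inner: "x \<bullet> z = (\<Sum>S\<in>UNIV. t S * (z \<bullet> ind S)) + c * (z \<bullet> ind UNIV)" for z
    by (subst x) (simp add: inner_add_left inner_sum_left inner_commute[of "ind _"])
  have "x \<bullet> w' \<le> x \<bullet> w" if w': "w' \<in> base_polytope G" for w'
  proof -
    have "t S * (w' \<bullet> ind S) \<le> t S * (w \<bullet> ind S)" for S
    proof (cases "t S = 0")
      case False
      then have "tight G w S"
        using w t[of S] by (simp add: less_le)
      then show ?thesis
        using w' t(1) by (auto simp: tight_def base_polytope_ind intro!: mult_left_mono)
    qed simp
    then have "(\<Sum>S\<in>UNIV. t S * (w' \<bullet> ind S)) \<le> (\<Sum>S\<in>UNIV. t S * (w \<bullet> ind S))"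
      by (intro sum_mono)
    then show ?thesis
      using w w' by (simp add: x_inner base_polytope_ind)
  qed
  then show "w \<in> lovasz_subdiff G x"
    using w by (simp add: lovasz_subdiff_iff)
qed

lemma lovasz_subdiff_mono:
  assumes "submodular G" "G {} = 0" "\<And>S. upset y S \<Longrightarrow> upset x S"
  shows "lovasz_subdiff G x \<subseteq> lovasz_subdiff G y"
  using assms(3) by (auto simp: lovasz_subdiff_tight[OF assms(1,2)])

lemma upset_perturb:
  fixes x d :: "real ^ 'v::finite"
  shows "\<exists>\<epsilon>>0. \<forall>S. upset x S \<longrightarrow> upset (x + \<epsilon> *\<^sub>R d) S"
proof -
  have "\<exists>\<epsilon>>0. x $ b < x $ a \<longrightarrow> (\<forall>r. 0 < r \<and> r \<le> \<epsilon> \<longrightarrow> x $ b + r * d $ b < x $ a + r * d $ a)" for a b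
  proof (cases "x $ b < x $ a")
    case True
    \<comment> \<open>The summand 1 avoids division by zero and makes the estimate below
      strict.\<close>
    define \<epsilon> where "\<epsilon> = (x $ a - x $ b) / (1 + \<bar>d $ b - d $ a\<bar>)"
    have "r * (d $ b - d $ a) < x $ a - x $ b" if "0 < r" "r \<le> \<epsilon>" for r
    proof -
      have "r * (d $ b - d $ a) < r * (1 + \<bar>d $ b - d $ a\<bar>)"
        using that by (intro mult_strict_left_mono) auto
      also have "\<dots> \<le> x $ a - x $ b"
        using that by (simp add: \<epsilon>_def pos_le_divide_eq add_pos_nonneg)
      finally show ?thesis .
    qed
    moreover have "0 < \<epsilon>"
      using True by (simp add: \<epsilon>_def add_pos_nonneg)
    ultimately show ?thesis
      by (intro exI[of _ \<epsilon>]) (auto simp: algebra_simps)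
  qed (auto intro: exI[of _ 1])
  then have "\<exists>\<epsilon>. \<forall>a b. \<epsilon> a b > 0 \<and> (x $ b < x $ a \<longrightarrow>
      (\<forall>r. 0 < r \<and> r \<le> \<epsilon> a b \<longrightarrow> x $ b + r * d $ b < x $ a + r * d $ a))"
    by (intro choice allI)
  then obtain \<epsilon> where \<epsilon>: "\<And>a b. 0 < \<epsilon> a b" "\<And>a b r. x $ b < x $ a \<Longrightarrow> 0 < r \<Longrightarrow> r \<le> \<epsilon> a b
      \<Longrightarrow> x $ b + r * d $ b < x $ a + r * d $ a"
    by blast
  define r where "r = Min (range (\<lambda>(a, b). \<epsilon> a b))"
  have "0 < r"
    unfolding r_def using \<epsilon>(1) by (subst Min_gr_iff) auto
  moreover have "r \<le> \<epsilon> a b" for a b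
    unfolding r_def by (rule Min_le) auto
  ultimately show ?thesis
    using \<epsilon>(2) by (intro exI[of _ r]) (auto simp: upset_def)
qed

section \<open>Compactness and convexity of the base polytope and its faces\<close>

lemma compact_base_polytope: "compact (base_polytope G)"
proof -
  have "base_polytope G = (\<Inter>S. {w. w \<bullet> ind S \<le> G S}) \<inter> {w. w \<bullet> ind UNIV = G UNIV}"
    by (auto simp: base_polytope_ind)
  moreover have "closed \<dots>"
    by (intro closed_Int closed_INT ballI closed_Collect_le closed_Collect_eq continuous_intros)
  ultimately have "closed (base_polytope G)" by simp
  moreover have "bounded (base_polytope G)"
  proof -
    have "norm w \<le> (\<Sum>v\<in>UNIV. \<bar>G {v}\<bar> + \<bar>G (- {v})\<bar> + \<bar>G UNIV\<bar>)" if w: "w \<in> base_polytope G" for w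
    proof -
      \<comment> \<open>The singleton bounds \<open>w $ v\<close> from above; its complement,
        together with the fixed total, bounds it from below.\<close>
      have "\<bar>w $ v\<bar> \<le> \<bar>G {v}\<bar> + \<bar>G (- {v})\<bar> + \<bar>G UNIV\<bar>" for v
      proof -
        have "(\<Sum>i\<in>{v}. w $ i) \<le> G {v}" "(\<Sum>i\<in>-{v}. w $ i) \<le> G (-{v})" "(\<Sum>i\<in>UNIV. w $ i) = G UNIV"
          using w unfolding base_polytope_def by blast+
        moreover have "(\<Sum>i\<in>UNIV. w $ i) = w $ v + (\<Sum>i\<in>-{v}. w $ i)"
          by (simp add: sum.remove[of UNIV v] Compl_eq_Diff_UNIV)
        ultimately show ?thesis by simp
      qed
      then have "(\<Sum>v\<in>UNIV. \<bar>w $ v\<bar>) \<le> (\<Sum>v\<in>UNIV. \<bar>G {v}\<bar> + \<bar>G (- {v})\<bar> + \<bar>G UNIV\<bar>)"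
        by (intro sum_mono)
      with norm_le_l1_cart[of w] show ?thesis by linarith
    qed
    then show ?thesis by (auto simp: bounded_iff)
  qed
  ultimately show ?thesis by (simp add: compact_eq_bounded_closed)
qed

lemma convex_base_polytope: "convex (base_polytope G)"
proof -
  have "base_polytope G = (\<Inter>S. {w. ind S \<bullet> w \<le> G S}) \<inter> {w. ind UNIV \<bullet> w = G UNIV}"
    by (auto simp: base_polytope_ind inner_commute)
  moreover have "convex \<dots>"
    by (intro convex_Int convex_INT convex_halfspace_le convex_hyperplane)
  ultimately show ?thesis by simp
qed

text \<open>The maximisers form a face, a hyperplane slice of the base polytope, which therefore
  inherits compactness and convexity.\<close>

lemma lovasz_subdiff_Int:
  "w \<in> lovasz_subdiff G x \<Longrightarrow> lovasz_subdiff G x = base_polytope G \<inter> {w'. x \<bullet> w' = x \<bullet> w}"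
  by (auto simp: lovasz_subdiff_iff intro: antisym)

lemma compact_convex_lovasz_subdiff:
  "compact (lovasz_subdiff G x)" "convex (lovasz_subdiff G x)"
proof -
  show "compact (lovasz_subdiff G x)"
  proof (cases "lovasz_subdiff G x = {}")
    case False
    then obtain w where "w \<in> lovasz_subdiff G x" by blast
    from lovasz_subdiff_Int[OF this] show ?thesis
      by (simp add: compact_Int_closed compact_base_polytope closed_hyperplane)
  qed simp
  show "convex (lovasz_subdiff G x)"
  proof (cases "lovasz_subdiff G x = {}")
    case False
    then obtain w where "w \<in> lovasz_subdiff G x" by blast
    from lovasz_subdiff_Int[OF this] show ?thesis
      by (simp add: convex_Int convex_base_polytope convex_hyperplane)
  qed simp
qed

section \<open>The energy of a submodular transformation\<close>

lemma compact_set_sum: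
  fixes A :: "'e \<Rightarrow> 'a::real_normed_vector set"
  assumes "\<And>e. e \<in> E \<Longrightarrow> compact (A e)"
  shows "compact (\<Sum>e\<in>E. A e)"
  using assms
proof (induction E rule: infinite_finite_induct)
  case (insert e E)
  have "A e + B = {x + y | x y. x \<in> A e \<and> y \<in> B}" for B
    by (auto simp: set_plus_def)
  then show ?case
    using insert by (simp add: compact_sums)
qed (auto simp: set_zero)

locale normalized_submodular =
  fixes E :: "'e set" and F :: "'v::finite set \<Rightarrow> 'e \<Rightarrow> real"
  assumes finite_E: "finite E"
    and transformation: "submodular_transformation E F"
    and normalized: "normalized E F"
begin

abbreviation "base e \<equiv> base_polytope (\<lambda>S. F S e)"
abbreviation "subdiff e \<equiv> lovasz_subdiff (\<lambda>S. F S e)"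

text \<open>The Lovasz extension, read off at one chosen maximiser; \<open>lov_eq\<close> shows that
  the choice does not matter.\<close>

definition lov :: "'e \<Rightarrow> real ^ 'v \<Rightarrow> real" where
  "lov e x = x \<bullet> (SOME w. w \<in> subdiff e x)"

lemma F_props:
  assumes "e \<in> E"
  shows "submodular (\<lambda>S. F S e)" "F {} e = 0" "F UNIV e = 0" "0 \<le> F S e"
  using assms transformation normalized
  by (auto simp: submodular_transformation_def normalized_def)

lemma zero_in_base: "e \<in> E \<Longrightarrow> 0 \<in> base e"
  by (simp add: base_polytope_ind F_props)

lemma subdiff_nonempty:
  assumes "e \<in> E"
  shows "\<exists>w. w \<in> subdiff e x"
proof -
  have "\<exists>w\<in>base e. \<forall>w'\<in>base e. x \<bullet> w' \<le> x \<bullet> w"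
    using zero_in_base[OF assms]
    by (intro continuous_attains_sup compact_base_polytope continuous_intros) auto
  then show ?thesis by (auto simp: lovasz_subdiff_iff)
qed

lemma subdiff_mono:
  assumes "e \<in> E" "\<And>S. upset y S \<Longrightarrow> upset x S" "w \<in> subdiff e x"
  shows "w \<in> subdiff e y"
  using lovasz_subdiff_mono[OF F_props(1,2)[OF assms(1)] assms(2)] assms(3) by blast

lemma subdiff_base: "w \<in> subdiff e x \<Longrightarrow> w \<in> base e"
  by (simp add: lovasz_subdiff_iff)

lemma lov_eq:
  assumes "w \<in> subdiff e x"
  shows "lov e x = x \<bullet> w"
proof -
  have "(SOME w. w \<in> subdiff e x) \<in> subdiff e x"
    using assms by (rule someI)
  then show ?thesis
    using assms by (auto simp: lov_def lovasz_subdiff_iff intro: antisym)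
qed

lemma lov_ge:
  assumes "e \<in> E" "w \<in> base e"
  shows "x \<bullet> w \<le> lov e x"
proof -
  obtain w' where w': "w' \<in> subdiff e x"
    using subdiff_nonempty[OF assms(1)] by blast
  then show ?thesis
    using assms(2) by (auto simp: lov_eq lovasz_subdiff_iff)
qed

lemma lov_nonneg: "e \<in> E \<Longrightarrow> 0 \<le> lov e x"
  using lov_ge[OF _ zero_in_base, of e x] by simp

text \<open>A maximum of linear functions is convex, and a finite convex function on the whole space
  is continuous.\<close>

lemma continuous_on_lov:
  assumes e: "e \<in> E"
  shows "continuous_on UNIV (lov e)"
proof (rule convex_on_continuous)
  show "convex_on UNIV (lov e)"
  proof
    fix t :: real and x y :: "real ^ 'v"
    assume t: "0 < t" "t < 1"
    obtain w where w: "w \<in> subdiff e ((1 - t) *\<^sub>R x + t *\<^sub>R y)"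
      using subdiff_nonempty[OF e] by blast
    have "lov e ((1 - t) *\<^sub>R x + t *\<^sub>R y) = (1 - t) * (x \<bullet> w) + t * (y \<bullet> w)"
      by (simp add: lov_eq[OF w] inner_add_left)
    also have "\<dots> \<le> (1 - t) * lov e x + t * lov e y"
      using t lov_ge[OF e subdiff_base[OF w]] by (intro add_mono mult_left_mono) auto
    finally show "lov e ((1 - t) *\<^sub>R x + t *\<^sub>R y) \<le> (1 - t) * lov e x + t * lov e y" .
  qed simp
qed simp

lemma in_laplacian_iff:
  "b \<in> laplacian E F x \<longleftrightarrow>
     (\<exists>w. (\<forall>e\<in>E. w e \<in> subdiff e x) \<and> b = (\<Sum>e\<in>E. lov e x *\<^sub>R w e))"
proof -
  have "(\<Sum>e\<in>E. (w e \<bullet> x) *\<^sub>R w e) = (\<Sum>e\<in>E. lov e x *\<^sub>R w e)" if "\<forall>e\<in>E. w e \<in> subdiff e x" for w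
    using that by (intro sum.cong) (auto simp: lov_eq inner_commute)
  then show ?thesis
    unfolding laplacian_def mem_Collect_eq by (intro iff_exI) auto
qed

section \<open>The dual objective and its link with potentials\<close>

text \<open>Twice the concave dual objective: the effective resistance is its maximum over \<open>x\<close>.\<close>

definition energy :: "real ^ 'v \<Rightarrow> real ^ 'v \<Rightarrow> real" where
  "energy b x = 2 * (b \<bullet> x) - (\<Sum>e\<in>E. (lov e x)\<^sup>2)"

text \<open>Weak duality: \<open>b \<bullet> y\<close> is at most the sum of
  \<open>lov e x * lov e y\<close>, and \<open>2 * r * s \<le> r\<^sup>2 + s\<^sup>2\<close>
  finishes. At \<open>y = x\<close> the bound is an equality.\<close>

lemma energy_le_laplacian:
  assumes "b \<in> laplacian E F x"
  shows "energy b y \<le> b \<bullet> x"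
proof -
  obtain w where w: "\<And>e. e \<in> E \<Longrightarrow> w e \<in> subdiff e x" and b: "b = (\<Sum>e\<in>E. lov e x *\<^sub>R w e)"
    using assms in_laplacian_iff by blast
  have "b \<bullet> x = (\<Sum>e\<in>E. (lov e x)\<^sup>2)"
    unfolding b inner_sum_left using lov_eq[OF w]
    by (intro sum.cong) (auto simp: power2_eq_square inner_commute)
  moreover have "2 * (b \<bullet> y) \<le> (\<Sum>e\<in>E. (lov e x)\<^sup>2 + (lov e y)\<^sup>2)"
    unfolding b inner_sum_left sum_distrib_left
  proof (rule sum_mono)
    fix e assume e: "e \<in> E"
    have "lov e x * (y \<bullet> w e) \<le> lov e x * lov e y"
      using e w by (intro mult_left_mono lov_ge lov_nonneg subdiff_base)
    then show "2 * ((lov e x *\<^sub>R w e) \<bullet> y) \<le> (lov e x)\<^sup>2 + (lov e y)\<^sup>2"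
      using sum_squares_bound[of "lov e x" "lov e y"] by (simp add: inner_commute)
  qed
  ultimately show ?thesis
    by (simp add: energy_def sum.distrib)
qed

text \<open>If \<open>y\<close> and \<open>x - y\<close> are both comonotone with \<open>x\<close>, the Lovasz extensions split as
  \<open>lov e x = lov e y + lov e (x - y)\<close>, with the same maximiser for all three.\<close>

lemma comonotone_part:
  assumes b: "b \<in> laplacian E F x"
    and y: "\<And>S. upset y S \<Longrightarrow> upset x S" "\<And>S. upset (x - y) S \<Longrightarrow> upset x S"
  shows "(\<Sum>e\<in>E. (lov e y)\<^sup>2) \<le> b \<bullet> y"
proof -
  obtain w where w: "\<And>e. e \<in> E \<Longrightarrow> w e \<in> subdiff e x" and b: "b = (\<Sum>e\<in>E. lov e x *\<^sub>R w e)"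
    using b in_laplacian_iff by blast
  show ?thesis
    unfolding b inner_sum_left
  proof (rule sum_mono)
    fix e assume e: "e \<in> E"
    have "lov e x = x \<bullet> w e" "lov e y = y \<bullet> w e" "lov e (x - y) = (x - y) \<bullet> w e"
      using e w y by (auto intro!: lov_eq intro: subdiff_mono)
    \<comment> \<open>The remainder \<open>x - y\<close> contributes a nonnegative amount to
      \<open>lov e x\<close>.\<close>
    moreover from this have "lov e y \<le> lov e x"
      using lov_nonneg[OF e, of "x - y"] by (simp add: inner_diff_left)
    then have "lov e y * lov e y \<le> lov e x * lov e y"
      using lov_nonneg[OF e] by (intro mult_right_mono)
    ultimately show "(lov e y)\<^sup>2 \<le> (lov e x *\<^sub>R w e) \<bullet> y"
      by (simp add: power2_eq_square inner_commute)
  qed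
qed

lemma potential_differences_le:
  assumes x: "axis u 1 - axis w 1 \<in> laplacian E F x"
  shows "axis u 1 - axis v 1 \<in> laplacian E F p \<Longrightarrow> x $ u - x $ v \<le> (axis u 1 - axis v 1) \<bullet> p"
    and "axis v 1 - axis w 1 \<in> laplacian E F q \<Longrightarrow> x $ v - x $ w \<le> (axis v 1 - axis w 1) \<bullet> q"
proof -
  have ax: "(axis i 1 - axis j 1) \<bullet> z = z $ i - z $ j" for i j and z :: "real ^ 'v"
    by (simp add: inner_diff_left inner_axis')
  \<comment> \<open>The parts of \<open>x\<close> above and below the height \<open>x $ v\<close>,
    both shifted to vanish at \<open>v\<close>; their sum is \<open>x\<close> minus the constant
    \<open>x $ v\<close>.\<close>
  define y where "y = (\<chi> i. max (x $ i) (x $ v) - x $ v)"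
  define z where "z = (\<chi> i. min (x $ i) (x $ v) - x $ v)"
  have "upset x S" if "upset y S \<or> upset (x - y) S \<or> upset z S \<or> upset (x - z) S" for S
  proof -
    have "x $ i < x $ j" if "y $ i < y $ j \<or> (x - y) $ i < (x - y) $ j \<or> z $ i < z $ j \<or> (x - z) $ i < (x - z) $ j"
      for i j
      using that by (auto simp: y_def z_def max_def min_def split: if_splits)
    then show ?thesis
      using that unfolding upset_def by blast
  qed
  then have *: "(\<Sum>e\<in>E. (lov e y)\<^sup>2) \<le> y $ u - y $ w" "(\<Sum>e\<in>E. (lov e z)\<^sup>2) \<le> z $ u - z $ w"
    using comonotone_part[OF x, of y] comonotone_part[OF x, of z] by (auto simp: ax)
  have yz: "y $ v = 0" "z $ v = 0" "0 \<le> y $ w" "x $ u - x $ v \<le> y $ u"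
      "z $ u \<le> 0" "z $ w \<le> x $ w - x $ v"
    by (auto simp: y_def z_def)
  \<comment> \<open>The energy of \<open>y\<close> is at least
    \<open>2 * y $ u - (y $ u - y $ w) = y $ u + y $ w\<close>; that of \<open>z\<close> in the
    second claim is at least \<open>- z $ u - z $ w\<close>.\<close>
  show "x $ u - x $ v \<le> (axis u 1 - axis v 1) \<bullet> p" if "axis u 1 - axis v 1 \<in> laplacian E F p"
    using energy_le_laplacian[OF that, of y] * yz by (simp add: energy_def ax)
  show "x $ v - x $ w \<le> (axis v 1 - axis w 1) \<bullet> q" if "axis v 1 - axis w 1 \<in> laplacian E F q"
    using energy_le_laplacian[OF that, of z] * yz by (simp add: energy_def ax)
qed

text \<open>The Lovasz extensions are linear on a segment starting at \<open>x\<close>, so if \<open>b\<close> were separated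
  from the convex compact set \<open>laplacian E F x\<close> by \<open>d\<close>, moving along \<open>d\<close> would increase the energy.\<close>

lemma maximiser_in_laplacian:
  assumes max: "\<And>y. energy b y \<le> energy b x"
  shows "b \<in> laplacian E F x"
proof (rule ccontr)
  assume b: "b \<notin> laplacian E F x"
  \<comment> \<open>The Laplacian written as a Minkowski sum, from which compactness and convexity
    follow.\<close>
  define K where "K = (\<Sum>e\<in>E. (\<lambda>w. lov e x *\<^sub>R w) ` subdiff e x)"
  have K_I: "(\<Sum>e\<in>E. lov e x *\<^sub>R w e) \<in> K" if "\<forall>e\<in>E. w e \<in> subdiff e x" for w
    using that unfolding K_def set_sum_alt[OF finite_E] by blast
  have "b \<notin> K"
  proof
    assume "b \<in> K"
    then obtain s where s: "b = sum s E" "\<forall>e\<in>E. \<exists>w. w \<in> subdiff e x \<and> s e = lov e x *\<^sub>R w"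
      unfolding K_def set_sum_alt[OF finite_E] by blast
    then obtain w where "\<forall>e\<in>E. w e \<in> subdiff e x \<and> s e = lov e x *\<^sub>R w e"
      by metis
    with s(1) b show False
      by (auto simp: in_laplacian_iff)
  qed
  have "compact K" "convex K"
    unfolding K_def
    by (auto intro!: compact_set_sum convex_set_sum compact_scaling convex_scaling
        compact_convex_lovasz_subdiff)
  then obtain d' r where d': "d' \<bullet> b < r" "\<And>k. k \<in> K \<Longrightarrow> r < d' \<bullet> k"
    using separating_hyperplane_closed_point[of K b] \<open>b \<notin> K\<close> compact_imp_closed by blast
  \<comment> \<open>The separation puts \<open>b\<close> on the lower side; the sign change makes
    \<open>d\<close> an ascent direction.\<close>
  define d where "d = - d'"
  obtain \<epsilon> where \<epsilon>: "0 < \<epsilon>" "\<And>S. upset x S \<Longrightarrow> upset (x + \<epsilon> *\<^sub>R d) S"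
    using upset_perturb[of x d] by blast
  have "\<exists>w. \<forall>e\<in>E. w e \<in> subdiff e (x + \<epsilon> *\<^sub>R d)"
    by (intro bchoice ballI subdiff_nonempty)
  then obtain w where w: "\<And>e. e \<in> E \<Longrightarrow> w e \<in> subdiff e (x + \<epsilon> *\<^sub>R d)"
    by blast
  \<comment> \<open>A maximiser at the far end of the segment is one at \<open>x\<close>, hence at
    every point between.\<close>
  have wx: "w e \<in> subdiff e x" if "e \<in> E" for e
    using subdiff_mono[OF that \<epsilon>(2) w[OF that]] .
  \<comment> \<open>Along the segment, \<open>energy b (x + t *\<^sub>R d) = energy b x + 2 * t * g
    - t\<^sup>2 * Q\<close>, with \<open>Q\<close> defined below.\<close>
  define g where "g = b \<bullet> d - (\<Sum>e\<in>E. lov e x * (w e \<bullet> d))"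
  have "0 < g"
  proof -
    have "(\<Sum>e\<in>E. lov e x *\<^sub>R w e) \<in> K"
      using wx by (intro K_I) auto
    from d'(2)[OF this] d'(1) show ?thesis
      by (simp add: g_def d_def inner_sum_right inner_commute sum_negf)
  qed
  define Q where "Q = (\<Sum>e\<in>E. (w e \<bullet> d)\<^sup>2)"
  have Q: "0 \<le> Q" unfolding Q_def by (intro sum_nonneg) auto
  have step: "2 * g \<le> t * Q" if t: "0 < t" "t \<le> \<epsilon>" for t
  proof -
    have lov_t: "lov e (x + t *\<^sub>R d) = lov e x + t * (w e \<bullet> d)" if e: "e \<in> E" for e
    proof -
      have "w e \<in> subdiff e (x + t *\<^sub>R d)"
        unfolding lovasz_subdiff_iff
      proof (intro conjI ballI)
        show "w e \<in> base e" using w[OF e] subdiff_base by blast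
        fix w' assume w': "w' \<in> base e"
        have 1: "x \<bullet> w' \<le> x \<bullet> w e" "(x + \<epsilon> *\<^sub>R d) \<bullet> w' \<le> (x + \<epsilon> *\<^sub>R d) \<bullet> w e"
          using w' w[OF e] wx[OF e] by (auto simp: lovasz_subdiff_iff)
        have conv: "x + t *\<^sub>R d = (1 - t / \<epsilon>) *\<^sub>R x + (t / \<epsilon>) *\<^sub>R (x + \<epsilon> *\<^sub>R d)"
          using \<epsilon>(1) by (simp add: algebra_simps)
        have "(1 - t / \<epsilon>) * (x \<bullet> w') + (t / \<epsilon>) * ((x + \<epsilon> *\<^sub>R d) \<bullet> w')
          \<le> (1 - t / \<epsilon>) * (x \<bullet> w e) + (t / \<epsilon>) * ((x + \<epsilon> *\<^sub>R d) \<bullet> w e)"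
          using 1 t \<epsilon>(1) by (intro add_mono mult_left_mono) auto
        then show "(x + t *\<^sub>R d) \<bullet> w' \<le> (x + t *\<^sub>R d) \<bullet> w e"
          unfolding conv by (simp only: inner_add_left[of "(1 - t / \<epsilon>) *\<^sub>R x"] inner_scaleR_left)
      qed
      then show ?thesis
        using lov_eq[OF wx[OF e]] by (simp add: lov_eq inner_add_left inner_commute[of d])
    qed
    have "(\<Sum>e\<in>E. (lov e (x + t *\<^sub>R d))\<^sup>2) =
        (\<Sum>e\<in>E. (lov e x)\<^sup>2 + 2 * t * (lov e x * (w e \<bullet> d)) + t\<^sup>2 * (w e \<bullet> d)\<^sup>2)"
      by (intro sum.cong) (auto simp: lov_t power2_eq_square algebra_simps)
    also have "\<dots> = (\<Sum>e\<in>E. (lov e x)\<^sup>2) + 2 * t * (b \<bullet> d - g) + t\<^sup>2 * Q"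
      by (simp add: sum.distrib sum_distrib_left g_def Q_def)
    finally have "t * (2 * g) \<le> t * (t * Q)"
      using max[of "x + t *\<^sub>R d"]
      by (simp add: energy_def inner_add_right algebra_simps power2_eq_square)
    then show ?thesis using t by simp
  qed
  \<comment> \<open>This gives \<open>t * Q \<le> g < 2 * g\<close>, contradicting
    \<open>step\<close>.\<close>
  define t where "t = min \<epsilon> (g / (Q + 1))"
  have t: "0 < t" "t \<le> \<epsilon>" "t \<le> g / (Q + 1)"
    using \<open>0 < g\<close> \<epsilon>(1) Q by (auto simp: t_def)
  have "t * Q \<le> t * (Q + 1)" using t by simp
  also have "\<dots> \<le> g" using t(3) Q by (simp add: pos_le_divide_eq)
  finally show False using step[OF t(1,2)] \<open>0 < g\<close> by simp
qed

section \<open>Existence of an energy maximiser\<close>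

text \<open>Layers \<open>S\<close> with \<open>F S e = 0\<close> for all \<open>e\<close> are dropped from the layer-cake representation
  of \<open>x\<close>; the weights of the remaining ones are controlled by the Lovasz extensions.\<close>

lemma bounded_representative:
  assumes b: "b = (\<Sum>e\<in>E. \<psi> e *\<^sub>R w e)" "\<And>e. e \<in> E \<Longrightarrow> 0 \<le> \<psi> e" "\<And>e. e \<in> E \<Longrightarrow> w e \<in> base e"
  shows "\<exists>C. \<forall>x. \<exists>y. energy b x \<le> energy b y \<and> norm y \<le> C * (\<Sum>e\<in>E. lov e x)"
proof -
  define N where "N = {S. \<exists>e\<in>E. F S e \<noteq> 0}"
  \<comment> \<open>A positive lower bound for the total value of any kept layer; the 1 covers an
    empty \<open>N\<close>.\<close>
  define m where "m = Min (insert 1 ((\<lambda>S. \<Sum>e\<in>E. F S e) ` N))"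
  have sum_pos': "0 < (\<Sum>e\<in>E. F S e)" if "S \<in> N" for S
    using that F_props(4) by (auto simp: N_def finite_E less_le sum_nonneg sum_nonneg_eq_0_iff)
  then have m: "0 < m"
    unfolding m_def by (subst Min_gr_iff) auto
  have m_le: "m \<le> (\<Sum>e\<in>E. F S e)" if "S \<in> N" for S
    unfolding m_def using that by (intro Min_le) auto
  have "\<exists>y. energy b x \<le> energy b y \<and> norm y \<le> real CARD('v) / m * (\<Sum>e\<in>E. lov e x)" for x
  proof -
    obtain t c where t: "\<And>S. 0 \<le> t S" "\<And>S. 0 < t S \<Longrightarrow> upset x S"
      and x: "x = (\<Sum>S\<in>UNIV. t S *\<^sub>R ind S) + c *\<^sub>R ind UNIV"
      using layer_cake[of x] by blast
    define y where "y = (\<Sum>S\<in>N. t S *\<^sub>R ind S)"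
    have x_inner: "x \<bullet> z = (\<Sum>S\<in>UNIV. t S * (z \<bullet> ind S)) + c * (z \<bullet> ind UNIV)" for z
      by (subst x) (simp add: inner_add_left inner_sum_left inner_commute[of "ind _"])
    have y_inner: "y \<bullet> z = (\<Sum>S\<in>N. t S * (z \<bullet> ind S))" for z
      by (simp add: y_def inner_sum_left inner_commute[of "ind _"])
    have lov_x: "lov e x = (\<Sum>S\<in>N. t S * F S e)" if e: "e \<in> E" for e
    proof -
      obtain w' where w': "w' \<in> subdiff e x"
        using subdiff_nonempty[OF e] by blast
      have "t S * (w' \<bullet> ind S) = t S * F S e" for S
      proof (cases "t S = 0")
        case False
        then have "upset x S" using t[of S] by (simp add: less_le)
        then show ?thesis
          using tight_upset[OF F_props(1,2)[OF e] w'] by (simp add: tight_def)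
      qed simp
      then have "(\<Sum>S\<in>UNIV. t S * (w' \<bullet> ind S)) = (\<Sum>S\<in>UNIV. t S * F S e)"
        by (intro sum.cong refl)
      moreover have "w' \<bullet> ind UNIV = 0"
        using subdiff_base[OF w'] by (simp add: base_polytope_ind F_props e)
      ultimately have "lov e x = (\<Sum>S\<in>UNIV. t S * F S e)"
        by (simp add: lov_eq[OF w'] x_inner)
      also have "\<dots> = (\<Sum>S\<in>N. t S * F S e)"
        using e by (intro sum.mono_neutral_right) (auto simp: N_def)
      finally show ?thesis .
    qed
    have lov_y: "lov e y \<le> lov e x" if e: "e \<in> E" for e
    proof -
      obtain w' where w': "w' \<in> subdiff e y"
        using subdiff_nonempty[OF e] by blast
      have "lov e y = (\<Sum>S\<in>N. t S * (w' \<bullet> ind S))"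
        by (simp add: lov_eq[OF w'] y_inner)
      also have "\<dots> \<le> (\<Sum>S\<in>N. t S * F S e)"
        using t(1) subdiff_base[OF w'] by (intro sum_mono mult_left_mono) (auto simp: base_polytope_ind)
      finally show ?thesis by (simp add: lov_x e)
    qed
    \<comment> \<open>Dropping layers cannot lower the linear term: \<open>b\<close> has nonpositive
      weight on each set outside \<open>N\<close>, and weight 0 on \<open>UNIV\<close>.\<close>
    have "b \<bullet> x \<le> b \<bullet> y"
    proof -
      have b_ind: "b \<bullet> ind S = (\<Sum>e\<in>E. \<psi> e * (w e \<bullet> ind S))" for S
        by (simp add: b(1) inner_sum_left)
      have "b \<bullet> ind UNIV = 0"
        unfolding b_ind using b(3) by (intro sum.neutral) (auto simp: base_polytope_ind F_props)
      moreover have "b \<bullet> ind S \<le> 0" if "S \<notin> N" for S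
      proof -
        have "\<psi> e * (w e \<bullet> ind S) \<le> \<psi> e * F S e" if "e \<in> E" for e
          using b(2,3) that by (intro mult_left_mono) (auto simp: base_polytope_ind)
        moreover have "F S e = 0" if "e \<in> E" for e
          using that \<open>S \<notin> N\<close> by (auto simp: N_def)
        ultimately show ?thesis
          unfolding b_ind by (intro sum_nonpos) auto
      qed
      then have "(\<Sum>S\<in>-N. t S * (b \<bullet> ind S)) \<le> 0"
        using t(1) by (intro sum_nonpos mult_nonneg_nonpos) auto
      moreover have "(\<Sum>S\<in>UNIV. t S * (b \<bullet> ind S)) =
          (\<Sum>S\<in>N. t S * (b \<bullet> ind S)) + (\<Sum>S\<in>-N. t S * (b \<bullet> ind S))"
        using sum.subset_diff[of N UNIV "\<lambda>S. t S * (b \<bullet> ind S)"] by (simp add: Compl_eq_Diff_UNIV)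
      ultimately show ?thesis
        using x_inner[of b] y_inner[of b] by (simp add: inner_commute)
    qed
    moreover have "(\<Sum>e\<in>E. (lov e y)\<^sup>2) \<le> (\<Sum>e\<in>E. (lov e x)\<^sup>2)"
      by (intro sum_mono power_mono lov_y lov_nonneg)
    ultimately have "energy b x \<le> energy b y"
      by (simp add: energy_def)
    moreover have "norm y \<le> real CARD('v) / m * (\<Sum>e\<in>E. lov e x)"
    proof -
      have "norm y \<le> (\<Sum>S\<in>N. norm (t S *\<^sub>R (ind S :: real ^ 'v)))"
        unfolding y_def by (rule norm_sum)
      also have "\<dots> \<le> (\<Sum>S\<in>N. t S * real CARD('v))"
        using t(1) by (intro sum_mono) (simp add: mult_left_mono norm_ind_le)
      \<comment> \<open>Scaling by \<open>m\<close> allows each layer's weight to be charged to its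
        total value, and thus to the Lovasz extensions of \<open>x\<close>.\<close>
      also have "\<dots> = real CARD('v) / m * (\<Sum>S\<in>N. t S * m)"
        using m by (simp add: sum_distrib_left sum_distrib_right mult.commute)
      also have "\<dots> \<le> real CARD('v) / m * (\<Sum>S\<in>N. t S * (\<Sum>e\<in>E. F S e))"
        using m t(1) by (intro mult_left_mono sum_mono m_le) auto
      also have "(\<Sum>S\<in>N. t S * (\<Sum>e\<in>E. F S e)) = (\<Sum>e\<in>E. lov e x)"
        by (simp add: sum_distrib_left lov_x sum.swap[of _ N E])
      finally show ?thesis .
    qed
    ultimately show ?thesis by blast
  qed
  then show ?thesis by blast
qed

text \<open>The energy need not be coercive in \<open>x\<close>, but quadratic growth bounds the sum
  of the Lovasz extensions wherever it is nonnegative. Such points have representatives in one fixed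
  ball, which also contains 0, where the energy is 0.\<close>

lemma energy_attained:
  assumes b: "b = (\<Sum>e\<in>E. \<psi> e *\<^sub>R w e)" "\<And>e. e \<in> E \<Longrightarrow> 0 \<le> \<psi> e" "\<And>e. e \<in> E \<Longrightarrow> w e \<in> base e"
  shows "\<exists>x. \<forall>y. energy b y \<le> energy b x"
proof -
  obtain C where C: "\<And>x. \<exists>y. energy b x \<le> energy b y \<and> norm y \<le> C * (\<Sum>e\<in>E. lov e x)"
    using bounded_representative[OF b] by blast
  \<comment> \<open>The constant comes from completing the square in
    \<open>0 \<le> (lov e y - (\<psi> e + 1/2))\<^sup>2\<close>; the absolute value is there because
    the sign of \<open>C\<close> is unknown.\<close>
  define M where "M = \<bar>C\<bar> * (\<Sum>e\<in>E. (\<psi> e + 1/2)\<^sup>2)"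
  have "0 \<le> M" by (auto simp: M_def intro!: mult_nonneg_nonneg sum_nonneg)
  have "continuous_on (cball 0 M) (energy b)"
    unfolding energy_def
    by (intro continuous_intros continuous_on_subset[OF continuous_on_lov]) auto
  then obtain x where x: "x \<in> cball 0 M" "\<And>y. y \<in> cball 0 M \<Longrightarrow> energy b y \<le> energy b x"
    using continuous_attains_sup[of "cball 0 M" "energy b"] \<open>0 \<le> M\<close> by auto
  have "energy b y \<le> energy b x" for y
  proof (cases "0 \<le> energy b y")
    case True
    have "b \<bullet> y \<le> (\<Sum>e\<in>E. \<psi> e * lov e y)"
      unfolding b(1) inner_sum_left
      using b(2,3) lov_ge[of _ _ y] by (intro sum_mono) (simp add: mult_left_mono inner_commute[of _ y])
    then have nonpos: "(\<Sum>e\<in>E. (lov e y)\<^sup>2 - 2 * (\<psi> e * lov e y)) \<le> 0"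
      using True by (simp add: energy_def sum_subtractf sum_distrib_left[symmetric])
    have "(\<Sum>e\<in>E. lov e y) \<le> (\<Sum>e\<in>E. ((lov e y)\<^sup>2 - 2 * (\<psi> e * lov e y)) + (\<psi> e + 1/2)\<^sup>2)"
    proof (rule sum_mono)
      fix e
      have "0 \<le> (lov e y - (\<psi> e + 1/2))\<^sup>2" by simp
      then show "lov e y \<le> ((lov e y)\<^sup>2 - 2 * (\<psi> e * lov e y)) + (\<psi> e + 1/2)\<^sup>2"
        by (simp add: power2_eq_square algebra_simps)
    qed
    also have "\<dots> \<le> (\<Sum>e\<in>E. (\<psi> e + 1/2)\<^sup>2)"
      unfolding sum.distrib using nonpos by simp
    finally have "C * (\<Sum>e\<in>E. lov e y) \<le> M"
      unfolding M_def by (intro mult_mono) (auto intro!: sum_nonneg lov_nonneg)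
    moreover obtain y' where y': "energy b y \<le> energy b y'" "norm y' \<le> C * (\<Sum>e\<in>E. lov e y)"
      using C by blast
    ultimately show ?thesis
      using x(2)[of y'] by simp
  next
    case False
    have "lov e 0 = 0" for e
      by (simp add: lov_def)
    then have "energy b 0 = 0" by (simp add: energy_def)
    then show ?thesis using False x(2)[of 0] \<open>0 \<le> M\<close> by simp
  qed
  then show ?thesis by blast
qed

section \<open>Superposition of flows and the triangle inequality\<close>

text \<open>Flows are added, not potentials: for each \<open>e\<close>, convexity merges the two
  flows into one base point with weight \<open>\<psi> e\<close>. A potential for the sum then arises
  as an energy maximiser.\<close>

lemma laplacian_add:
  assumes "b \<in> laplacian E F x" "c \<in> laplacian E F y"
  shows "\<exists>z. b + c \<in> laplacian E F z"
proof -
  obtain w where w: "\<And>e. e \<in> E \<Longrightarrow> w e \<in> subdiff e x" and b: "b = (\<Sum>e\<in>E. lov e x *\<^sub>R w e)"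
    using assms(1) in_laplacian_iff by blast
  obtain w' where w': "\<And>e. e \<in> E \<Longrightarrow> w' e \<in> subdiff e y" and c: "c = (\<Sum>e\<in>E. lov e y *\<^sub>R w' e)"
    using assms(2) in_laplacian_iff by blast
  define \<psi> where "\<psi> e = lov e x + lov e y" for e
  have "\<exists>v\<in>base e. \<psi> e *\<^sub>R v = lov e x *\<^sub>R w e + lov e y *\<^sub>R w' e" if e: "e \<in> E" for e
  proof (cases "\<psi> e = 0")
    case True
    then have "lov e x = 0" "lov e y = 0"
      using lov_nonneg[OF e, of x] lov_nonneg[OF e, of y] by (auto simp: \<psi>_def)
    then show ?thesis
      using zero_in_base[OF e] by (intro bexI[of _ 0]) auto
  next
    case False
    then have pos: "0 < \<psi> e"
      using lov_nonneg[OF e, of x] lov_nonneg[OF e, of y] by (auto simp: \<psi>_def)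
    have "(lov e x / \<psi> e) *\<^sub>R w e + (lov e y / \<psi> e) *\<^sub>R w' e \<in> base e"
    proof (rule convexD[OF convex_base_polytope])
      show "lov e x / \<psi> e + lov e y / \<psi> e = 1"
        using False by (simp add: \<psi>_def add_divide_distrib[symmetric])
      show "w e \<in> base e" "w' e \<in> base e"
        using w[OF e] w'[OF e] subdiff_base by blast+
    qed (use pos lov_nonneg[OF e] in auto)
    then show ?thesis
      using False by (intro bexI) (auto simp: scaleR_add_right)
  qed
  then obtain v where v: "\<And>e. e \<in> E \<Longrightarrow> v e \<in> base e"
      "\<And>e. e \<in> E \<Longrightarrow> \<psi> e *\<^sub>R v e = lov e x *\<^sub>R w e + lov e y *\<^sub>R w' e"
    by metis
  have "b + c = (\<Sum>e\<in>E. \<psi> e *\<^sub>R v e)"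
    by (simp add: b c v(2) sum.distrib)
  moreover have "0 \<le> \<psi> e" if "e \<in> E" for e
    using lov_nonneg[OF that] by (simp add: \<psi>_def)
  ultimately obtain z where "\<forall>y. energy (b + c) y \<le> energy (b + c) z"
    using energy_attained[of "b + c" \<psi> v] v(1) by blast
  then show ?thesis
    using maximiser_in_laplacian by blast
qed

end

theorem theorem4:
  fixes E :: "'e set"
    and F :: "'v::finite set \<Rightarrow> 'e \<Rightarrow> real"
    and u v w :: 'v
  assumes "finite E"
    and "submodular_transformation E F"
    and "normalized E F"
  shows "effective_resistance E F u v + effective_resistance E F v w
           \<ge> effective_resistance E F u w"
proof -
  interpret normalized_submodular E F
    using assms by unfold_locales
  note R_eq = effective_resistance_eq[OF assms(2,3)]
  show ?thesis
  proof (cases "(\<exists>p. axis u 1 - axis v 1 \<in> laplacian E F p) \<and> (\<exists>q. axis v 1 - axis w 1 \<in> laplacian E F q)")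
    case False
    \<comment> \<open>A resistance is real or \<open>\<infinity>\<close>, never minus infinity, so
      one infinite term makes the sum infinite.\<close>
    then have "effective_resistance E F u v + effective_resistance E F v w = \<infinity>"
      by (auto simp: effective_resistance_def)
    then show ?thesis by (simp only: ereal_less_eq)
  next
    case True
    then obtain p q where p: "axis u 1 - axis v 1 \<in> laplacian E F p"
      and q: "axis v 1 - axis w 1 \<in> laplacian E F q" by blast
    obtain x where x: "axis u 1 - axis w 1 \<in> laplacian E F x"
      using laplacian_add[OF p q] by auto
    have "(axis u 1 - axis w 1) \<bullet> x = x $ u - x $ w"
      by (simp add: inner_diff_left inner_axis')
    \<comment> \<open>The two differences of \<open>x\<close> telescope to
      \<open>x $ u - x $ w\<close>.\<close>
    then show ?thesis
      using potential_differences_le[OF x] p q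
      by (simp add: R_eq[OF p] R_eq[OF q] R_eq[OF x]) fastforce
  qed
qed

end
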